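(* Let $f=a_0+a_1x+\cdots+a_nx^n\in\mathbb{Z}[x]$ be a primitive polynomial such that each zero $\theta\in\mathbb{C}$ of $f$ satisfies $|\theta|>d$, where $a_n=\pm p^k d$ for some positive integers $k$ and $d$, and a prime $p\nmid d$. Let $j\in\{1,\ldots,n\}$ be such that $\gcd(k,j)=1$, $p^k\mid\gcd(a_{n-j+1},a_{n-j+2},\ldots,a_n)$, and, in the case $k>1$, $p\nmid a_{n-j}$. If $|a_0/q|\leq|a_n|$, where $q$ is the smallest prime divisor of $a_0$, then $f$ is irreducible in $\mathbb{Z}[x]$.
   Context: A polynomial with integer coefficients is called primitive if the greatest common divisor of all its coefficients is $1$. *)

theory Defs
  imports Complex_Main "HOL-Computational_Algebra.Computational_Algebra"
begin

end

theory Submission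
  imports Defs
begin

text \<open>
  Evaluating a polynomial at \<open>0\<close> gives, up to sign, the leading coefficient times the product of
  the zeros. So if all zeros lie outside the disc of radius \<open>d\<close>, every non-constant factor has a
  large constant term compared with its leading coefficient. Suppose \<open>f = g h\<close> with both factors
  non-constant, and suppose that \<open>p ^ k\<close> divides the leading coefficient of \<open>g\<close>. Then
  \<open>\<bar>g(0)\<bar> > p ^ k d = \<bar>a\<^sub>n\<bar>\<close>, and \<open>\<bar>h(0)\<bar> > 1\<close>. The second bound gives \<open>h(0)\<close> a prime divisor,
  so \<open>\<bar>h(0)\<bar> \<ge> q\<close> and \<open>\<bar>a\<^sub>0\<bar> / q \<ge> \<bar>g(0)\<bar> > \<bar>a\<^sub>n\<bar>\<close>, contrary to the hypothesis
  (\<open>no_split_with_dominant_lead_coeff\<close>).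

  What is left is arithmetic: the power \<open>p ^ k\<close> cannot be shared between the two leading
  coefficients. For \<open>k = 1\<close> this holds because \<open>p\<close> is prime. For \<open>k > 1\<close> it is Dumas' argument on
  the Newton polygon of \<open>f\<close> at \<open>p\<close>: the polygon has the edge from \<open>(n - j, 0)\<close> to \<open>(n, k)\<close>, which
  contains no further lattice point as \<open>k\<close> and \<open>j\<close> are coprime, so the whole edge comes from one of
  the two factors (\<open>primitive_last_edge_not_split\<close>). The polygon enters only through the linear
  functional that is constant on this edge, and the fact behind the argument is that the minimum of
  such a functional is additive under multiplication (\<open>exists_additive_minimal_weights\<close>).
\<close>

section \<open>Weighted valuations of coefficients\<close>

text \<open>
  A linear functional on the points \<open>(i, v)\<close> of the Newton polygon, with \<open>v\<close> the \<open>p\<close>-adic valuation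
  of the \<open>i\<close>-th coefficient; it is constant along edges of slope \<open>k / j\<close>. Values at vanishing
  coefficients carry no meaning, which is why the facts below restrict to nonzero ones.
\<close>

definition coeff_weight ::
    "'a :: {factorial_semiring, idom} \<Rightarrow> nat \<Rightarrow> nat \<Rightarrow> 'a poly \<Rightarrow> nat \<Rightarrow> int" where
  "coeff_weight p j k g i = int j * int (multiplicity p (coeff g i)) - int k * int i"

lemma exists_first_minimal_weight:
  assumes "g \<noteq> 0"
  obtains s where "coeff g s \<noteq> 0"
    "\<And>i. coeff g i \<noteq> 0 \<Longrightarrow> coeff_weight p j k g s \<le> coeff_weight p j k g i"
    "\<And>i. coeff g i \<noteq> 0 \<Longrightarrow> i < s \<Longrightarrow> coeff_weight p j k g s < coeff_weight p j k g i"
proof -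
  define S where "S = {i. coeff g i \<noteq> 0}"
  define w where "w = coeff_weight p j k g"
  have "S \<subseteq> {..degree g}" unfolding S_def using le_degree by auto
  hence fin: "finite S" using finite_subset by blast
  have "degree g \<in> S" using assms by (simp add: S_def)
  hence "S \<noteq> {}" by auto
  define T where "T = {i \<in> S. w i = Min (w ` S)}"
  have "Min (w ` S) \<in> w ` S" using fin \<open>S \<noteq> {}\<close> by simp
  hence "\<exists>i. i \<in> T" by (auto simp: T_def)
  hence "(LEAST i. i \<in> T) \<in> T" by (rule LeastI_ex)
  moreover have "i \<notin> T" if "i < (LEAST i. i \<in> T)" for i
    using that not_less_Least by blast
  ultimately obtain s where s: "s \<in> T" "\<And>i. i < s \<Longrightarrow> i \<notin> T" by blast
  have le: "w s \<le> w i" if "i \<in> S" for i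
    using s(1) that fin by (simp add: T_def)
  have "w s < w i" if "i \<in> S" "i < s" for i
    using le[OF that(1)] s that by (fastforce simp: T_def)
  with le s(1) show ?thesis
    by (intro that[of s]) (auto simp: S_def T_def w_def)
qed

text \<open>
  A version of Gauss's lemma. Take the first index of minimal weight in each factor; in the
  coefficient of the product at the sum of these indices, any other term involves an index that is
  smaller than the chosen one in one of the factors, hence has strictly larger weight and so
  strictly larger valuation. A sum with a unique term of least valuation has that valuation.
\<close>

lemma exists_additive_minimal_weights:
  fixes g h :: "'a :: {factorial_semiring, idom} poly"
  assumes p: "prime_elem p" and j: "j > 0" and nz: "g \<noteq> 0" "h \<noteq> 0"
  obtains s t where
    "\<And>i. coeff g i \<noteq> 0 \<Longrightarrow> coeff_weight p j k g s \<le> coeff_weight p j k g i"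
    "\<And>i. coeff h i \<noteq> 0 \<Longrightarrow> coeff_weight p j k h t \<le> coeff_weight p j k h i"
    "coeff (g * h) (s + t) \<noteq> 0"
    "coeff_weight p j k (g * h) (s + t) = coeff_weight p j k g s + coeff_weight p j k h t"
proof -
  obtain s where s: "coeff g s \<noteq> 0"
    "\<And>i. coeff g i \<noteq> 0 \<Longrightarrow> coeff_weight p j k g s \<le> coeff_weight p j k g i"
    "\<And>i. coeff g i \<noteq> 0 \<Longrightarrow> i < s \<Longrightarrow> coeff_weight p j k g s < coeff_weight p j k g i"
    by (rule exists_first_minimal_weight[OF nz(1), where p = p and j = j and k = k]) blast
  obtain t where t: "coeff h t \<noteq> 0"
    "\<And>i. coeff h i \<noteq> 0 \<Longrightarrow> coeff_weight p j k h t \<le> coeff_weight p j k h i"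
    "\<And>i. coeff h i \<noteq> 0 \<Longrightarrow> i < t \<Longrightarrow> coeff_weight p j k h t < coeff_weight p j k h i"
    by (rule exists_first_minimal_weight[OF nz(2), where p = p and j = j and k = k]) blast
  define e where "e = multiplicity p (coeff g s) + multiplicity p (coeff h t)"
  let ?c = "\<lambda>i. coeff g i * coeff h (s + t - i)"
  have np: "\<not> is_unit p" using p by (simp add: prime_elem_def)
  have mult_term: "multiplicity p (coeff g i * coeff h l)
      = multiplicity p (coeff g i) + multiplicity p (coeff h l)"
    if "coeff g i \<noteq> 0" "coeff h l \<noteq> 0" for i l
    using that p by (simp add: prime_elem_multiplicity_mult_distrib)
  have other: "p ^ Suc e dvd ?c i" if i: "i \<le> s + t" "i \<noteq> s" for i
  proof (cases "?c i = 0")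
    case False
    hence c: "coeff g i \<noteq> 0" "coeff h (s + t - i) \<noteq> 0" by auto
    have "coeff_weight p j k g s + coeff_weight p j k h t
        < coeff_weight p j k g i + coeff_weight p j k h (s + t - i)"
    proof (cases "i < s")
      case True
      with s(3)[OF c(1)] t(2)[OF c(2)] show ?thesis by linarith
    next
      case False
      with i have "s + t - i < t" by linarith
      with t(3)[OF c(2)] s(2)[OF c(1)] show ?thesis by linarith
    qed
    \<comment> \<open>The index parts of the weights add up to the same amount on both sides and cancel.\<close>
    hence "int j * int e < int j * int (multiplicity p (?c i))"
      using i(1) by (simp add: coeff_weight_def e_def mult_term c of_nat_diff algebra_simps)
    hence "Suc e \<le> multiplicity p (?c i)" using j by simp
    thus ?thesis by (rule multiplicity_dvd')
  next
    case True
    thus ?thesis by (simp only: dvd_0_right)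
  qed
  have split: "coeff (g * h) (s + t) = ?c s + (\<Sum>i\<in>{..s + t} - {s}. ?c i)"
    unfolding coeff_mult by (rule sum.remove) auto
  have rest: "p ^ Suc e dvd (\<Sum>i\<in>{..s + t} - {s}. ?c i)"
    by (rule dvd_sum) (use other in auto)
  have ce: "multiplicity p (?c s) = e" using s(1) t(1) by (simp add: mult_term e_def)
  have "?c s \<noteq> 0" using s(1) t(1) by simp
  hence "\<not> p ^ Suc e dvd ?c s" using ce np by (simp add: power_dvd_iff_le_multiplicity del: power_Suc)
  hence nd: "\<not> p ^ Suc e dvd coeff (g * h) (s + t)"
    unfolding split using rest by (metis dvd_add_left_iff)
  have "p ^ e dvd ?c s" using ce by (metis multiplicity_dvd)
  moreover have "p ^ e dvd (\<Sum>i\<in>{..s + t} - {s}. ?c i)"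
    using rest by (metis dvd_trans le_imp_power_dvd lessI less_imp_le)
  ultimately have "p ^ e dvd coeff (g * h) (s + t)" unfolding split by (rule dvd_add)
  hence "multiplicity p (coeff (g * h) (s + t)) = e" using nd by (rule multiplicity_eqI)
  hence "coeff_weight p j k (g * h) (s + t) = coeff_weight p j k g s + coeff_weight p j k h t"
    by (simp add: coeff_weight_def e_def algebra_simps)
  moreover have "coeff (g * h) (s + t) \<noteq> 0" using nd by auto
  ultimately show ?thesis using that s(2) t(2) by blast
qed

section \<open>The last edge of the Newton polygon\<close>

text \<open>
  The hypotheses say that the Newton polygon of \<open>g h\<close> ends with an edge from \<open>(n - j, 0)\<close> to
  \<open>(n, k)\<close>, on which the weight is minimal. Both ends decompose: the right one into the leading
  coefficients, the left one into two coefficients, at indices \<open>a\<close> and \<open>b\<close> with \<open>a + b = n - j\<close>,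
  that are prime to \<open>p\<close>. As minimal weights add, all four coefficients have minimal weight in their
  factor. Equality of the two weights in \<open>g\<close> makes \<open>j\<close> divide \<open>k (degree g - a)\<close>, hence
  \<open>degree g - a\<close>. As \<open>(degree g - a) + (degree h - b) = j\<close>, this number is \<open>0\<close> or \<open>j\<close>; the leading
  coefficient of \<open>g\<close> is prime to \<open>p\<close> in the first case, that of \<open>h\<close> in the second.
\<close>

lemma primitive_last_edge_not_split:
  fixes g h :: "'a :: {factorial_semiring, idom} poly"
  assumes p: "prime_elem p" and nz: "g \<noteq> 0" "h \<noteq> 0"
    and j: "0 < j" "j \<le> degree (g * h)" and cop: "coprime k j"
    and lead: "multiplicity p (lead_coeff (g * h)) = k"
    and upper: "\<And>i. degree (g * h) - j < i \<Longrightarrow> p ^ k dvd coeff (g * h) i"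
    and lower: "\<not> p dvd coeff (g * h) (degree (g * h) - j)"
  shows "\<not> p dvd lead_coeff g \<or> \<not> p dvd lead_coeff h"
proof -
  define n where "n = degree (g * h)"
  let ?w = "coeff_weight p j k"
  have np: "\<not> is_unit p" using p by (simp add: prime_elem_def)
  have n: "n = degree g + degree h" using nz by (simp add: n_def degree_mult_eq)
  have jn: "j \<le> n" using j by (simp add: n_def)
  have bound: "- int k * int (n - j) \<le> ?w (g * h) i" if i: "coeff (g * h) i \<noteq> 0" for i
  proof (cases "n - j < i")
    case True
    have "k \<le> multiplicity p (coeff (g * h) i)"
      using upper[of i] True i np by (simp add: n_def power_dvd_iff_le_multiplicity)
    hence "int j * int k \<le> int j * int (multiplicity p (coeff (g * h) i))"
      by (intro mult_left_mono) auto
    moreover have "int k * int i \<le> int k * int n"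
      using i le_degree by (intro mult_left_mono) (auto simp: n_def)
    ultimately show ?thesis using jn by (simp add: coeff_weight_def of_nat_diff algebra_simps)
  next
    case False
    hence "int k * int i \<le> int k * int (n - j)" by (intro mult_left_mono) auto
    moreover have "0 \<le> int j * int (multiplicity p (coeff (g * h) i))" by simp
    ultimately show ?thesis unfolding coeff_weight_def mult_minus_left by linarith
  qed
  obtain s t where
    sg: "\<And>i. coeff g i \<noteq> 0 \<Longrightarrow> ?w g s \<le> ?w g i" and
    th: "\<And>i. coeff h i \<noteq> 0 \<Longrightarrow> ?w h t \<le> ?w h i" and
    st: "coeff (g * h) (s + t) \<noteq> 0" "?w (g * h) (s + t) = ?w g s + ?w h t"
    by (rule exists_additive_minimal_weights[OF p j(1) nz, where k = k]) blast
  have low: "- int k * int (n - j) \<le> ?w g s + ?w h t" using bound[OF st(1)] st(2) by simp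
  have lc: "multiplicity p (lead_coeff g) + multiplicity p (lead_coeff h) = k"
    using lead nz p by (simp add: lead_coeff_mult prime_elem_multiplicity_mult_distrib)
  have "\<exists>a\<le>n - j. \<not> p dvd coeff g a * coeff h (n - j - a)"
    using lower unfolding n_def[symmetric] coeff_mult by (metis (no_types, lifting) atMost_iff dvd_sum)
  then obtain a where a: "a \<le> n - j" "\<not> p dvd coeff g a * coeff h (n - j - a)" by blast
  define b where "b = n - j - a"
  have ab: "a + b = n - j" using a by (simp add: b_def)
  have nd: "\<not> p dvd coeff g a" "\<not> p dvd coeff h b" using a by (auto simp: b_def)
  have cab: "coeff g a \<noteq> 0" "coeff h b \<noteq> 0" using nd by auto
  have wab: "?w g a = - int k * int a" "?w h b = - int k * int b"
    using nd by (simp_all add: coeff_weight_def not_dvd_imp_multiplicity_0)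
  have eq_ab: "?w g a + ?w h b = - int k * int (n - j)"
    unfolding wab by (simp add: ab[symmetric] algebra_simps)
  have "?w g (degree g) + ?w h (degree h) = int j * int k - int k * int n"
    by (simp add: coeff_weight_def lc[symmetric] n algebra_simps)
  also have "\<dots> = - int k * int (n - j)" using jn by (simp add: of_nat_diff algebra_simps)
  finally have eq_lc: "?w g (degree g) + ?w h (degree h) = - int k * int (n - j)" .
  have "?w g (degree g) = ?w g a"
    using eq_ab eq_lc low sg[OF cab(1)] th[OF cab(2)] sg[of "degree g"] th[of "degree h"] nz
    by simp
  hence g_eq: "int j * int (multiplicity p (lead_coeff g)) = int k * (int (degree g) - int a)"
    unfolding wab by (simp add: coeff_weight_def algebra_simps)
  have ag: "a \<le> degree g" "b \<le> degree h" using cab le_degree by auto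
  have g_eq': "j * multiplicity p (lead_coeff g) = k * (degree g - a)"
    using g_eq ag by (metis of_nat_diff of_nat_eq_iff of_nat_mult)
  have "j dvd k * (degree g - a)" unfolding g_eq'[symmetric] by simp
  hence dv: "j dvd degree g - a"
    using cop by (simp add: coprime_dvd_mult_right_iff coprime_commute)
  have sum: "(degree g - a) + (degree h - b) = j" using ab ag n jn by linarith
  have "degree g - a = 0 \<or> degree g - a = j"
    using dv sum by (metis dvd_imp_le le_add1 le_antisym not_gr_zero)
  thus ?thesis
  proof
    assume "degree g - a = 0"
    hence "multiplicity p (lead_coeff g) = 0" using g_eq' j by simp
    thus ?thesis using np nz by (simp add: multiplicity_eq_zero_iff)
  next
    assume "degree g - a = j"
    hence "multiplicity p (lead_coeff g) = k" using g_eq' j by simp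
    hence "multiplicity p (lead_coeff h) = 0" using lc by simp
    thus ?thesis using np nz by (simp add: multiplicity_eq_zero_iff)
  qed
qed

text \<open>
  The prime \<open>p\<close> divides only one of the leading coefficients, by the valuation \<open>1\<close> if \<open>k = 1\<close> and by
  the last edge of the polygon if \<open>k > 1\<close>; this one then takes the whole power \<open>p ^ k\<close>.
\<close>

lemma prime_power_dvd_lead_coeff_of_factor:
  fixes g h :: "'a :: {factorial_semiring, idom} poly"
  assumes p: "prime_elem p" and nz: "g \<noteq> 0" "h \<noteq> 0" and k: "k > 0"
    and j: "0 < j" "j \<le> degree (g * h)" and cop: "coprime k j"
    and lead: "multiplicity p (lead_coeff (g * h)) = k"
    and upper: "\<And>i. degree (g * h) - j < i \<Longrightarrow> p ^ k dvd coeff (g * h) i"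
    and lower: "k > 1 \<Longrightarrow> \<not> p dvd coeff (g * h) (degree (g * h) - j)"
  shows "p ^ k dvd lead_coeff g \<or> p ^ k dvd lead_coeff h"
proof -
  have lc: "multiplicity p (lead_coeff g) + multiplicity p (lead_coeff h) = k"
    using lead nz p by (simp add: lead_coeff_mult prime_elem_multiplicity_mult_distrib)
  have "multiplicity p (lead_coeff g) = 0 \<or> multiplicity p (lead_coeff h) = 0"
  proof (cases "k > 1")
    case True
    with primitive_last_edge_not_split[OF p nz j cop lead upper lower]
    show ?thesis by (auto simp: not_dvd_imp_multiplicity_0)
  next
    case False
    with lc k show ?thesis by linarith
  qed
  with lc show ?thesis by (auto intro: multiplicity_dvd')
qed

section \<open>Constant terms of polynomials with large zeros\<close>

text \<open>
  Vieta's formula for the constant term, as an inequality: each linear factor splits off a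
  zero and contributes more than \<open>d\<close>.
\<close>

lemma lead_coeff_bound_of_large_roots:
  fixes P :: "complex poly"
  assumes "d \<ge> 0" and "degree P > 0"
    and "\<And>z. poly P z = 0 \<Longrightarrow> d < cmod z"
  shows "cmod (lead_coeff P) * d ^ degree P < cmod (poly P 0)"
  using assms(2,3)
proof (induction "degree P" arbitrary: P)
  case (Suc m)
  obtain z where z: "poly P z = 0"
    using fundamental_theorem_of_algebra[of P] Suc.hyps(2)
    by (metis constant_degree nat.distinct(1))
  then obtain Q where Q: "P = [:- z, 1:] * Q" by (metis dvdE poly_eq_0_iff_dvd)
  have "Q \<noteq> 0" using Q Suc.hyps(2) by auto
  hence deg: "degree P = Suc (degree Q)"
    unfolding Q by (subst degree_mult_eq) auto
  have lead: "lead_coeff P = lead_coeff Q" unfolding Q lead_coeff_mult by simp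
  have p0: "cmod (poly P 0) = cmod z * cmod (poly Q 0)" unfolding Q by (simp add: norm_mult)
  have dz: "d < cmod z" using Suc.prems(2) z .
  have rootsQ: "d < cmod y" if "poly Q y = 0" for y using that Suc.prems(2)[of y] by (simp add: Q)
  have le: "cmod (lead_coeff Q) * d ^ degree Q \<le> cmod (poly Q 0)"
  proof (cases "degree Q = 0")
    case True
    thus ?thesis by (auto elim: degree_eq_zeroE)
  next
    case False
    thus ?thesis using Suc.hyps(1)[of Q] Suc.hyps(2) deg rootsQ by fastforce
  qed
  have "poly Q 0 \<noteq> 0" using rootsQ[of 0] assms(1) by auto
  hence "d * cmod (poly Q 0) < cmod z * cmod (poly Q 0)" using dz by simp
  moreover have "d * (cmod (lead_coeff Q) * d ^ degree Q) \<le> d * cmod (poly Q 0)"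
    using le assms(1) by (rule mult_left_mono)
  ultimately show ?case unfolding p0 lead unfolding deg by (simp add: mult_ac)
qed simp

lemma int_coeff_0_bound_of_large_roots:
  fixes g :: "int poly" and d :: nat
  assumes d: "d > 0" and deg: "degree g > 0"
    and roots: "\<And>z :: complex. poly (map_poly of_int g) z = 0 \<Longrightarrow> real d < cmod z"
  shows "\<bar>lead_coeff g\<bar> * int d < \<bar>coeff g 0\<bar>"
proof -
  let ?G = "map_poly of_int g :: complex poly"
  have dG: "degree ?G = degree g" by (rule degree_map_poly) simp
  have "cmod (lead_coeff ?G) * real d ^ degree ?G < cmod (poly ?G 0)"
    by (rule lead_coeff_bound_of_large_roots) (use roots deg in \<open>auto simp: dG\<close>)
  hence "real_of_int \<bar>lead_coeff g\<bar> * real d ^ degree g < real_of_int \<bar>coeff g 0\<bar>"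
    by (simp add: dG poly_0_coeff_0 coeff_map_poly)
  moreover have "real d ^ 1 \<le> real d ^ degree g"
    using d deg by (intro power_increasing) auto
  hence "real_of_int \<bar>lead_coeff g\<bar> * real d \<le> real_of_int \<bar>lead_coeff g\<bar> * real d ^ degree g"
    by (intro mult_left_mono) auto
  ultimately have "real_of_int (\<bar>lead_coeff g\<bar> * int d) < real_of_int \<bar>coeff g 0\<bar>" by simp
  thus ?thesis by linarith
qed

text \<open>
  The two factors play different parts: the constant term of \<open>g\<close> alone already exceeds the leading
  coefficient of the product, while the constant term of \<open>h\<close> is not a unit, hence has a prime
  divisor, and its size is at least \<open>q\<close>.
\<close>

lemma no_split_with_dominant_lead_coeff:
  fixes g h :: "int poly" and d q m :: nat
  assumes d: "d > 0" and deg: "degree g > 0" "degree h > 0"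
    and roots: "\<And>z :: complex. poly (map_poly of_int (g * h)) z = 0 \<Longrightarrow> real d < cmod z"
    and lead: "\<bar>lead_coeff (g * h)\<bar> = int (m * d)" and dvd: "int m dvd lead_coeff g"
    and q: "\<And>r :: nat. prime r \<Longrightarrow> int r dvd coeff (g * h) 0 \<Longrightarrow> q \<le> r"
    and q0: "q > 0"
  shows "\<bar>lead_coeff (g * h)\<bar> * int q < \<bar>coeff (g * h) 0\<bar>"
proof -
  have nz: "g \<noteq> 0" "h \<noteq> 0" using deg by auto
  have hom: "map_poly of_int (g * h) = (map_poly of_int g * map_poly of_int h :: complex poly)"
    by (intro poly_eqI) (simp add: coeff_map_poly coeff_mult)
  have "\<bar>lead_coeff g\<bar> * int d < \<bar>coeff g 0\<bar>"
    by (rule int_coeff_0_bound_of_large_roots) (use d deg roots in \<open>auto simp: hom\<close>)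
  moreover have "int m \<le> \<bar>lead_coeff g\<bar>" using dvd nz dvd_imp_le_int[of "lead_coeff g" "int m"] by simp
  hence "int m * int d \<le> \<bar>lead_coeff g\<bar> * int d" by (intro mult_right_mono) auto
  ultimately have g0: "\<bar>lead_coeff (g * h)\<bar> < \<bar>coeff g 0\<bar>" by (simp add: lead)
  have "\<bar>lead_coeff h\<bar> * int d < \<bar>coeff h 0\<bar>"
    by (rule int_coeff_0_bound_of_large_roots) (use d deg roots in \<open>auto simp: hom\<close>)
  moreover have "1 * 1 \<le> \<bar>lead_coeff h\<bar> * int d"
    using nz d by (intro mult_mono) (auto simp: int_one_le_iff_zero_less)
  ultimately have h0: "1 < \<bar>coeff h 0\<bar>" by linarith
  have "nat \<bar>coeff h 0\<bar> \<noteq> 1" using h0 by linarith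
  then obtain r where r: "prime r" "r dvd nat \<bar>coeff h 0\<bar>" using prime_factor_nat by blast
  hence "int r dvd coeff h 0" by simp
  moreover from this have "int r dvd coeff (g * h) 0" by (simp add: coeff_mult_0)
  ultimately have "int q \<le> \<bar>coeff h 0\<bar>"
    using q[OF r(1)] h0 by (smt (verit) dvd_imp_le_int of_nat_le_iff abs_of_nat)
  hence "\<bar>coeff g 0\<bar> * int q \<le> \<bar>coeff g 0\<bar> * \<bar>coeff h 0\<bar>" by (intro mult_left_mono) auto
  moreover have "\<bar>lead_coeff (g * h)\<bar> * int q < \<bar>coeff g 0\<bar> * int q" using g0 q0 by simp
  ultimately show ?thesis by (simp add: coeff_mult_0 abs_mult)
qed

section \<open>Irreducibility\<close>

lemma is_unit_factor_of_content_1: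
  fixes g h :: "'a :: {factorial_ring_gcd, semiring_gcd_mult_normalize} poly"
  assumes "content (g * h) = 1" and "degree g = 0"
  shows "is_unit g"
proof -
  obtain c where c: "g = [:c:]" using assms(2) by (auto elim: degree_eq_zeroE)
  have "is_unit (content g)" using assms(1) by (metis content_mult dvd_triv_left)
  thus ?thesis by (simp add: c is_unit_const_poly_iff)
qed

theorem theorem2:
  fixes f :: "int poly" and n p k d j q :: nat
  assumes "degree f = n"
    and "content f = 1"
    and "\<And>\<theta> :: complex. poly (map_poly of_int f) \<theta> = 0 \<Longrightarrow> real d < cmod \<theta>"
    and "coeff f n = int (p ^ k * d) \<or> coeff f n = - int (p ^ k * d)"
    and "k > 0" and "d > 0" and "prime p" and "\<not> p dvd d"
    and "j \<in> {1..n}" and "coprime k j"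
    and "int (p ^ k) dvd Gcd (coeff f ` {n - j + 1..n})"
    and "k > 1 \<Longrightarrow> \<not> int p dvd coeff f (n - j)"
    and "prime q" and "int q dvd coeff f 0"
    and "\<And>r :: nat. prime r \<Longrightarrow> int r dvd coeff f 0 \<Longrightarrow> q \<le> r"
    and "\<bar>real_of_int (coeff f 0) / real q\<bar> \<le> \<bar>real_of_int (coeff f n)\<bar>"
  shows "irreducible f"
proof (rule irreducibleI)
  have n: "n > 0" using assms(9) by auto
  show "f \<noteq> 0" using assms(2) by auto
  show "\<not> is_unit f" using n assms(1) by (auto simp: is_unit_poly_iff)
  fix g h assume f: "f = g * h"
  show "is_unit g \<or> is_unit h"
  proof (rule ccontr)
    assume nu: "\<not> (is_unit g \<or> is_unit h)"
    have deg: "degree g > 0" "degree h > 0"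
      using nu assms(2) is_unit_factor_of_content_1[of g h] is_unit_factor_of_content_1[of h g]
      by (auto simp: f mult.commute)
    have nz: "g \<noteq> 0" "h \<noteq> 0" using deg by auto
    have q0: "q > 0" using assms(13) prime_gt_0_nat by blast
    have pp: "prime_elem (int p)" using assms(7) by auto
    have lead: "\<bar>lead_coeff f\<bar> = int (p ^ k * d)" using assms(1,4) by auto
    have mult: "multiplicity (int p) (lead_coeff f) = k"
    proof (rule multiplicity_eqI)
      show "int p ^ k dvd lead_coeff f" using assms(1,4) by auto
      have "\<not> p ^ Suc k dvd p ^ k * d"
        using assms(7,8) by (simp add: prime_gt_0_nat mult.commute)
      hence "\<not> int (p ^ Suc k) dvd int (p ^ k * d)" unfolding int_dvd_int_iff .
      thus "\<not> int p ^ Suc k dvd lead_coeff f"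
        using assms(1,4) by (metis dvd_minus_iff of_nat_power)
    qed
    have upper: "int p ^ k dvd coeff f i" if "degree f - j < i" for i
    proof (cases "i \<le> n")
      case True
      hence "coeff f i \<in> coeff f ` {n - j + 1..n}" using that assms(1) by auto
      thus ?thesis using assms(11) by (metis Gcd_dvd dvd_trans of_nat_power)
    next
      case False
      thus ?thesis using assms(1) by (simp add: coeff_eq_0)
    qed
    have "int p ^ k dvd lead_coeff g \<or> int p ^ k dvd lead_coeff h"
      using prime_power_dvd_lead_coeff_of_factor[OF pp nz assms(5), of j]
        assms(1,9,10,12) mult upper unfolding f by auto
    hence "\<bar>lead_coeff f\<bar> * int q < \<bar>coeff f 0\<bar>"
    proof
      assume "int p ^ k dvd lead_coeff g"
      thus ?thesis
        using no_split_with_dominant_lead_coeff[OF assms(6) deg, of "p ^ k" q]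
          assms(3,15) lead q0 unfolding f by auto
    next
      assume "int p ^ k dvd lead_coeff h"
      thus ?thesis
        using no_split_with_dominant_lead_coeff[OF assms(6) deg(2,1), of "p ^ k" q]
          assms(3,15) lead q0 unfolding f by (auto simp: mult.commute[of h g])
    qed
    hence "real_of_int (\<bar>lead_coeff f\<bar> * int q) < real_of_int \<bar>coeff f 0\<bar>"
      unfolding of_int_less_iff .
    thus False using assms(1,16) q0 by (simp add: abs_divide divide_le_eq)
  qed
qed

end
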